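(* Let $n\ge 3$ and $d\ge 2$ be integers and let $P$ be the transition matrix of the Rook's Walk Birth-Death (RWBD) chain with parameters $n,d$. For every $m\in\{0,\dots,d\}$, the Krawtchouk polynomial $K_m=K_{m,d,n}$ is an eigenfunction of $P$ with eigenvalue $$\lambda_m=1-\frac{nm}{d(n-1)},$$ that is, $PK_m=\lambda_mK_m$ on $\{0,\dots,d\}$.
   Context: The RWBD chain with parameters $n,d$ is the Markov chain on $\Omega_*=\{0,\dots,d\}$ which from $x$ stays at $x$ with probability $\frac{x(n-2)}{d(n-1)}$, moves to $x-1$ with probability $\frac{x}{d(n-1)}$, and moves to $x+1$ with probability $\frac{d-x}{d}$. (It is the projection of the rook's random walk on $\{1,\dots,n\}^d$ to the Hamming distance from $(1,\dots,1)$.) With $P(x,y)$ the probability of moving from $x$ to $y$, $P$ acts on functions by $(Pf)(x)=\sum_{y\in\Omega_*}P(x,y)f(y)$. For $N,s\in\mathbb{N}$ with $s\ge2$ and $m\le N$, the Krawtchouk polynomial is $$K_{m,N,s}(x)=\sum_{j=0}^m(-1)^j\binom{x}{j}\binom{N-x}{m-j}(s-1)^{m-j},$$ with $\binom{x}{0}=1$ and $\binom{x}{j}=\frac{1}{j!}x(x-1)\cdots(x-j+1)$ for $j\ge1$. *)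

theory Defs
  imports Complex_Main
begin

(* Entry (x, y) of the transition matrix on the states {0..d}. The downward move is
   guarded by y + 1 = x, since x - 1 would truncate at x = 0 on nat. *)
definition rwbd_P :: "nat \<Rightarrow> nat \<Rightarrow> nat \<Rightarrow> nat \<Rightarrow> real" where
  "rwbd_P n d x y =
     (if y = x then real x * (real n - 2) / (real d * (real n - 1))
      else if y + 1 = x then real x / (real d * (real n - 1))
      else if y = x + 1 then (real d - real x) / real d
      else 0)"

definition rwbd_op :: "nat \<Rightarrow> nat \<Rightarrow> (nat \<Rightarrow> real) \<Rightarrow> nat \<Rightarrow> real" where
  "rwbd_op n d f x = (\<Sum>y\<in>{0..d}. rwbd_P n d x y * f y)"

(* Only the values of f on the state space {0..d} matter; an eigenfunction is nonzero there. *)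
definition rwbd_eigenfunction :: "nat \<Rightarrow> nat \<Rightarrow> (nat \<Rightarrow> real) \<Rightarrow> real \<Rightarrow> bool" where
  "rwbd_eigenfunction n d f l \<longleftrightarrow>
     (\<exists>x\<in>{0..d}. f x \<noteq> 0) \<and> (\<forall>x\<in>{0..d}. rwbd_op n d f x = l * f x)"

definition krawtchouk :: "nat \<Rightarrow> nat \<Rightarrow> nat \<Rightarrow> real \<Rightarrow> real" where
  "krawtchouk m N s x =
     (\<Sum>j=0..m. (-1) ^ j * (x gchoose j) * ((real N - x) gchoose (m - j)) * (real s - 1) ^ (m - j))"

end

theory Submission
  imports Defs "HOL-Computational_Algebra.Polynomial"
begin

text \<open>For fixed \<open>x\<close>, the values \<open>K\<^sub>m(x)\<close> are the coefficients in \<open>t\<close> of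
  \<open>G\<^sub>x(t) = (1 - t)\<^sup>x (1 + q t)\<^bsup>d-x\<^esup>\<close> with \<open>q = n - 1\<close>. Comparing coefficients of \<open>t\<^sup>m\<close> in
  \<open>x (q - 1) G\<^sub>x + x G\<^bsub>x-1\<^esub> + q (d - x) G\<^bsub>x+1\<^esub> = d q G\<^sub>x - (q + 1) t G\<^sub>x'\<close>
  gives the eigenvalue equation, scaled by \<open>d q\<close>.\<close>

definition krawtchouk_gf :: "'a::field_char_0 \<Rightarrow> nat \<Rightarrow> nat \<Rightarrow> 'a poly" where
  "krawtchouk_gf q x y = [:1, -1:] ^ x * [:1, q:] ^ y"

lemma coeff_one_plus_linear_power:
  "coeff ([:1, c:] ^ n) i = of_nat (n choose i) * (c::'a::comm_ring_1) ^ i"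
proof (induction n arbitrary: i)
  case 0
  show ?case by (cases i) simp_all
next
  case (Suc n)
  then show ?case by (cases i) (simp_all add: algebra_simps)
qed

text \<open>Cauchy product of two binomial expansions; \<open>x \<le> N\<close> makes
  \<open>N - x\<close> a natural number, so \<open>gchoose\<close> becomes
  \<open>choose\<close>.\<close>

lemma krawtchouk_eq_coeff:
  assumes "x \<le> N"
  shows "krawtchouk m N s (real x) = coeff (krawtchouk_gf (real s - 1) x (N - x)) m"
proof -
  have N: "real N - real x = real (N - x)"
    using assms by simp
  show ?thesis
    unfolding krawtchouk_def krawtchouk_gf_def coeff_mult atLeast0AtMost N
      coeff_one_plus_linear_power binomial_gbinomial
    by (simp add: ac_simps)
qed

lemma krawtchouk_at_0: "krawtchouk m N s 0 = real (N choose m) * (real s - 1) ^ m"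
  using krawtchouk_eq_coeff[of 0 N m s]
  by (simp add: krawtchouk_gf_def coeff_one_plus_linear_power)

text \<open>The product rule expresses the derivative by the powers with lowered exponents, and (q +
  1) t = (1 + q t) - (1 - t) turns these into the two neighbouring generating functions.\<close>

lemma krawtchouk_gf_identity:
  fixes q :: "'a::field_char_0"
  shows "smult (of_nat x * (q - 1)) (krawtchouk_gf q x y)
      + smult (of_nat x) (krawtchouk_gf q (x - 1) (y + 1))
      + smult (q * of_nat y) (krawtchouk_gf q (x + 1) (y - 1))
    = smult (of_nat (x + y) * q) (krawtchouk_gf q x y)
      - smult (q + 1) (pCons 0 (pderiv (krawtchouk_gf q x y)))"
\<comment> \<open>In characteristic 0 the field is infinite, so equality may be checked
  pointwise.\<close>
proof (intro poly_eq_poly_eq_iff[THEN iffD1] ext)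
  fix t :: 'a
  define A B where "A = 1 - t" and "B = 1 + q * t"
  have G: "poly (krawtchouk_gf q i j) t = A ^ i * B ^ j" for i j
    by (simp add: krawtchouk_gf_def A_def B_def algebra_simps)
  have "poly (pderiv (krawtchouk_gf q x y)) t
      = q * of_nat y * A ^ x * B ^ (y - 1) - of_nat x * A ^ (x - 1) * B ^ y"
    by (simp add: krawtchouk_gf_def A_def B_def pderiv_mult pderiv_power pderiv_pCons algebra_simps)
  \<comment> \<open>Here \<open>a\<close> and \<open>b\<close> stand for \<open>A ^ (x - 1)\<close>
    and \<open>B ^ (y - 1)\<close>. The factors \<open>X\<close> and \<open>Y\<close> in the
    hypotheses keep them true at exponent 0, where subtraction truncates.\<close>
  moreover have "X * (q - 1) * (P * Q) + X * (a * (B * Q)) + q * Y * (A * P * b)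
      = (X + Y) * q * (P * Q) - (q + 1) * (t * (q * Y * P * b - X * a * Q))"
    if "X * P = X * (A * a)" "Y * Q = Y * (B * b)" for X Y P Q a b
  proof -
    have "B = A + (q + 1) * t"
      by (simp add: A_def B_def algebra_simps)
    with that show ?thesis
      by algebra
  qed
  note this[of "of_nat x" "A ^ x" "A ^ (x - 1)" "of_nat y" "B ^ y" "B ^ (y - 1)"]
  moreover have "of_nat x * A ^ x = of_nat x * (A * A ^ (x - 1))"
    by (cases x) simp_all
  moreover have "of_nat y * B ^ y = of_nat y * (B * B ^ (y - 1))"
    by (cases y) simp_all
  ultimately show "poly (smult (of_nat x * (q - 1)) (krawtchouk_gf q x y)
      + smult (of_nat x) (krawtchouk_gf q (x - 1) (y + 1))
      + smult (q * of_nat y) (krawtchouk_gf q (x + 1) (y - 1))) t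
    = poly (smult (of_nat (x + y) * q) (krawtchouk_gf q x y)
      - smult (q + 1) (pCons 0 (pderiv (krawtchouk_gf q x y)))) t"
    by (simp add: G)
qed

lemma krawtchouk_difference_equation:
  fixes x N m s :: nat
  assumes "x \<le> N"
  defines "q \<equiv> real s - 1" and "K \<equiv> \<lambda>i. krawtchouk m N s (real i)"
  shows "real x * (q - 1) * K x + real x * K (x - 1) + q * (real N - real x) * K (x + 1)
    = (real N * q - (q + 1) * real m) * K x"
proof -
  have 1: "real x * K (x - 1) = real x * coeff (krawtchouk_gf q (x - 1) (N - x + 1)) m"
    using assms by (cases x) (simp_all add: krawtchouk_eq_coeff Suc_diff_Suc)
  \<comment> \<open>At \<open>x = N\<close> the coefficient formula does not cover
    \<open>K (x + 1)\<close>, but its weight vanishes.\<close>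
  have 2: "(real N - real x) * K (x + 1)
      = real (N - x) * coeff (krawtchouk_gf q (x + 1) (N - x - 1)) m"
    using assms krawtchouk_eq_coeff[of "x + 1" N m s] by (cases "x = N") simp_all
  \<comment> \<open>The operator t d/dt scales t^m by m; this makes the eigenvalue linear in
    \<open>m\<close>.\<close>
  have 3: "coeff (pCons 0 (pderiv p)) m = real m * coeff p m" for p
    by (cases m) (simp_all add: coeff_pderiv)
  have "real x * (q - 1) * K x + real x * K (x - 1) + q * (real N - real x) * K (x + 1)
      = coeff (smult (of_nat x * (q - 1)) (krawtchouk_gf q x (N - x))
        + smult (of_nat x) (krawtchouk_gf q (x - 1) (N - x + 1))
        + smult (q * of_nat (N - x)) (krawtchouk_gf q (x + 1) (N - x - 1))) m"
    using 1 2 assms(1) by (auto simp: K_def krawtchouk_eq_coeff q_def mult.assoc)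
  also have "\<dots> = (real N * q - (q + 1) * real m) * K x"
    unfolding krawtchouk_gf_identity coeff_diff coeff_smult 3
    using assms(1) by (simp add: K_def krawtchouk_eq_coeff q_def algebra_simps)
  finally show ?thesis .
qed

text \<open>One formula serves the boundary too: the weight of \<open>f (x - 1)\<close> is 0 at
  \<open>x = 0\<close>, and that of \<open>f (x + 1)\<close> is 0 at \<open>x = d\<close>.\<close>

lemma rwbd_op_eq:
  assumes "x \<le> d"
  shows "rwbd_op n d f x = real x * (real n - 2) / (real d * (real n - 1)) * f x
    + real x / (real d * (real n - 1)) * f (x - 1) + (real d - real x) / real d * f (x + 1)"
proof -
  have "rwbd_P n d x y * f y =
      (if y = x then real x * (real n - 2) / (real d * (real n - 1)) * f x else 0)
    + (if y = x - 1 then real x / (real d * (real n - 1)) * f (x - 1) else 0)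
    + (if y = x + 1 then (real d - real x) / real d * f (x + 1) else 0)" for y
    by (cases x) (auto simp: rwbd_P_def)
  then show ?thesis
    using assms by (auto simp: rwbd_op_def sum.distrib not_le le_Suc_eq)
qed

theorem theorem4:
  fixes n d m :: nat
  assumes "n \<ge> 3" and "d \<ge> 2" and "m \<le> d"
  shows "rwbd_eigenfunction n d (\<lambda>x. krawtchouk m d n (real x))
           (1 - real n * real m / (real d * (real n - 1)))"
  unfolding rwbd_eigenfunction_def
proof (intro conjI ballI)
  \<comment> \<open>At 0 the value is (d choose m) (n - 1)^m, which is positive.\<close>
  show "\<exists>x\<in>{0..d}. krawtchouk m d n (real x) \<noteq> 0"
    using assms by (intro bexI[of _ 0]) (auto simp: krawtchouk_at_0)
next
  fix x assume "x \<in> {0..d}"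
  then have x: "x \<le> d" by simp
  define K where "K = (\<lambda>i. krawtchouk m d n (real i))"
  define D where "D = real d * (real n - 1)"
  have D: "D \<noteq> 0" "real d \<noteq> 0" "real n - 1 \<noteq> 0" using assms by (auto simp: D_def)
  \<comment> \<open>Over the common denominator \<open>D\<close>, the numerator is the left side of
    the difference equation with q = n - 1.\<close>
  have "(real d - real x) / real d = (real n - 1) * (real d - real x) / D"
    using D by (simp add: D_def)
  then have "rwbd_op n d K x = (real x * (real n - 2) * K x + real x * K (x - 1)
      + (real n - 1) * (real d - real x) * K (x + 1)) / D"
    by (simp add: rwbd_op_eq[OF x] add_divide_distrib flip: D_def)
  also have "\<dots> = (D - real n * real m) * K x / D"
    using krawtchouk_difference_equation[OF x, of n m] by (simp add: K_def D_def)
  also have "\<dots> = (1 - real n * real m / D) * K x"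
    using D by (simp add: field_simps)
  finally show "rwbd_op n d (\<lambda>x. krawtchouk m d n (real x)) x
      = (1 - real n * real m / (real d * (real n - 1))) * krawtchouk m d n (real x)"
    by (simp add: K_def D_def)
qed

end
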